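(* For all integers $m,n\ge 2$, let $K_{m,n}$ be the complete bipartite graph with parts of sizes $m$ and $n$ and let $Sp(K_{m,n})$ be its splitting graph. Then $$\gamma_{ds}(Sp(K_{m,n}))=4.$$
   Context: All graphs are finite, simple and undirected. A set $S\subseteq V(G)$ is a dual-server dominating set (DS-dominating set) of a graph $G$ if there is a partition $\{R,B\}$ of $S$ such that every vertex of $V(G)\setminus S$ has at least one neighbour in $R$ and at least one neighbour in $B$. The dual-server domination number $\gamma_{ds}(G)$ is the minimum cardinality of a DS-dominating set of $G$. The splitting graph $Sp(G)$ of $G$ is obtained from $G$ by adding, for each vertex $v\in V(G)$, a new vertex $v'$ (the twin of $v$) adjacent exactly to the vertices of the open neighbourhood $N_G(v)$ of $v$ in $G$ (so twins are pairwise nonadjacent, and $v'$ is not adjacent to $v$). *)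

theory Defs
  imports "Graph_Theory.Graph_Theory" "HOL-Library.Disjoint_Sets"
begin

text \<open>
  Following the Graph_Theory entry, a finite simple undirected graph is a digraph satisfying the
  locale predicate \<^const>\<open>graph\<close>: finite, loop-free, without multiple arcs, and symmetric.
\<close>

definition neighbourhood :: "('a, 'b) pre_digraph \<Rightarrow> 'a \<Rightarrow> 'a set" where
  "neighbourhood G v = {u. v \<rightarrow>\<^bsub>G\<^esub> u}"

text \<open>
  The condition \<open>R \<noteq> B\<close> is needed because \<open>partition_on S {R, B}\<close> also holds for the
  one-block partition \<open>R = B = S\<close>. Both blocks of a partition are nonempty; this matters only
  for \<open>S = verts G\<close> with at most one vertex, since any vertex outside \<open>S\<close> has a neighbour in each
  block anyway.
\<close>

definition ds_dominating :: "('a, 'b) pre_digraph \<Rightarrow> 'a set \<Rightarrow> bool" where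
  "ds_dominating G S \<longleftrightarrow> S \<subseteq> verts G \<and>
     (\<exists>R B. partition_on S {R, B} \<and> R \<noteq> B \<and>
        (\<forall>v \<in> verts G - S. neighbourhood G v \<inter> R \<noteq> {} \<and> neighbourhood G v \<inter> B \<noteq> {}))"

text \<open>
  The minimum exists whenever \<open>G\<close> is finite with at least two vertices, because the whole vertex
  set is then DS-dominating.
\<close>

definition ds_domination_number :: "('a, 'b) pre_digraph \<Rightarrow> nat" where
  "ds_domination_number G = (LEAST k. \<exists>S. ds_dominating G S \<and> card S = k)"

text \<open>
  \<open>Inl v\<close> is the original vertex \<open>v\<close> and \<open>Inr v\<close> its twin. Each edge joining a twin to a vertex is
  given by its two arcs.
\<close>

definition splitting_graph :: "('a, 'b) pre_digraph \<Rightarrow> ('a + 'a) pair_pre_digraph" where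
  "splitting_graph G =
    \<lparr> pverts = Inl ` verts G \<union> Inr ` verts G,
      parcs = {(Inl u, Inl v) | u v. u \<rightarrow>\<^bsub>G\<^esub> v}
        \<union> {(Inr v, Inl u) | v u. v \<in> verts G \<and> u \<in> neighbourhood G v}
        \<union> {(Inl u, Inr v) | v u. v \<in> verts G \<and> u \<in> neighbourhood G v} \<rparr>"

lemma graph_splitting_graph:
  assumes "graph G"
  shows "graph (with_proj (splitting_graph G))"
proof -
  interpret graph G by fact
  have fin: "finite (pverts (splitting_graph G))"
    by (simp add: splitting_graph_def)
  have sub: "parcs (splitting_graph G) \<subseteq> pverts (splitting_graph G) \<times> pverts (splitting_graph G)"
    by (auto simp: splitting_graph_def neighbourhood_def dest: adj_in_verts)
  have irrefl: "(x, x) \<notin> parcs (splitting_graph G)" for x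
    by (auto simp: splitting_graph_def dest: adj_not_same)
  have sym: "sym (parcs (splitting_graph G))"
    using arcs_ends_symmetric[OF sym_arcs] by (auto simp: splitting_graph_def intro!: symI)
  have "finite (parcs (splitting_graph G))"
    using finite_subset[OF sub] fin by simp
  then have "pair_graph (splitting_graph G)"
    using fin sub irrefl sym by unfold_locales (auto simp: symmetric_def)
  then show ?thesis by (rule pair_graph.pair_graphD_graph)
qed

text \<open>Complete bipartite graphs of every size exist, with vertices in \<^typ>\<open>nat + nat\<close>.\<close>

lemma complete_bipartite_exists:
  "\<exists>G :: (nat + nat) pair_pre_digraph. K\<^bsub>m,n\<^esub> (with_proj G)"
proof -
  let ?U = "Inl ` {..<m} :: (nat + nat) set" and ?V = "Inr ` {..<n} :: (nat + nat) set"
  have "?U \<inter> ?V = {}" "card ?U = m" "card ?V = n"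
    by (auto simp: card_image)
  then have "K\<^bsub>m,n\<^esub> (with_proj \<lparr> pverts = ?U \<union> ?V, parcs = ?U \<times> ?V \<union> ?V \<times> ?U \<rparr>)"
    unfolding complete_bipartite_digraph_pair_def by (intro conjI exI[of _ ?U] exI[of _ ?V]) auto
  then show ?thesis ..
qed

end

theory Submission
  imports Defs
begin

text \<open>
  Let \<open>U\<close> and \<open>V\<close> be the parts of \<open>K\<^bsub>m,n\<^esub>\<close>. The twin of a vertex of \<open>U\<close> is adjacent only to
  original vertices in \<open>V\<close>. Hence either a DS-dominating set \<open>S\<close> contains all twins of \<open>U\<close>, and
  there are at least two of these, or it leaves out some twin, which must then see one vertex of
  each block of the partition of \<open>S\<close> inside \<open>V\<close>. In both cases \<open>S\<close> has at least two elements among the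
  twins of \<open>U\<close> and the vertices of \<open>V\<close> (\<open>two_le_card_Int_twins_and_neighbours\<close>). Exchanging the
  parts yields two elements among the twins of \<open>V\<close> and the vertices of \<open>U\<close>. The two unions are
  disjoint, so \<open>S\<close> has at least four elements.

  Conversely, two original vertices from each part suffice: with \<open>u\<^sub>1, u\<^sub>2 \<in> U\<close> and
  \<open>v\<^sub>1, v\<^sub>2 \<in> V\<close>, take the blocks \<open>{u\<^sub>1, v\<^sub>1}\<close> and \<open>{u\<^sub>2, v\<^sub>2}\<close>, since every vertex of the splitting
  graph is adjacent to all original vertices of one part.
\<close>

lemma verts_splitting_graph:
  "verts (with_proj (splitting_graph G)) = Inl ` verts G \<union> Inr ` verts G"
  by (simp add: splitting_graph_def)

lemma neighbourhood_splitting_graph_Inr: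
  assumes "v \<in> verts G"
  shows "neighbourhood (with_proj (splitting_graph G)) (Inr v) = Inl ` neighbourhood G v"
  using assms by (auto simp: neighbourhood_def splitting_graph_def)

lemma Inl_neighbourhood_subset_neighbourhood_splitting_graph:
  "Inl ` neighbourhood G v \<subseteq> neighbourhood (with_proj (splitting_graph G)) (Inl v)"
  by (auto simp: neighbourhood_def splitting_graph_def)

lemma ds_dominating_two_neighbours:
  assumes "ds_dominating G S" and "finite S" and "v \<in> verts G - S"
  shows "2 \<le> card (S \<inter> neighbourhood G v)"
proof -
  obtain R B where part: "partition_on S {R, B}" and "R \<noteq> B"
    and "neighbourhood G v \<inter> R \<noteq> {}" "neighbourhood G v \<inter> B \<noteq> {}"
    using assms(1,3) unfolding ds_dominating_def by blast
  then obtain r b where rb: "r \<in> R" "b \<in> B" "r \<in> neighbourhood G v" "b \<in> neighbourhood G v"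
    by blast
  have "R \<inter> B = {}" and S: "R \<union> B = S"
    using part \<open>R \<noteq> B\<close> by (auto simp: partition_on_def disjoint_def)
  then have "r \<noteq> b" using rb by blast
  then have "card {r, b} = 2" by simp
  moreover have "card {r, b} \<le> card (S \<inter> neighbourhood G v)"
    using rb S \<open>finite S\<close> by (intro card_mono) auto
  ultimately show ?thesis by simp
qed

lemma two_le_card_Int_twins_and_neighbours:
  assumes ds: "ds_dominating (with_proj (splitting_graph G)) S" and "finite S"
    and "U \<subseteq> verts G" and "2 \<le> card U"
    and nbh: "\<And>u. u \<in> U \<Longrightarrow> neighbourhood G u \<subseteq> V"
  shows "2 \<le> card (S \<inter> (Inr ` U \<union> Inl ` V))"
proof (cases "Inr ` U \<subseteq> S")
  case True
  have "2 \<le> card (Inr ` U :: ('a + 'a) set)"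
    using \<open>2 \<le> card U\<close> by (simp add: card_image)
  also have "\<dots> \<le> card (S \<inter> (Inr ` U \<union> Inl ` V))"
    using True \<open>finite S\<close> by (intro card_mono) auto
  finally show ?thesis .
next
  case False
  then obtain u where u: "u \<in> U" "Inr u \<notin> S" by blast
  let ?N = "neighbourhood (with_proj (splitting_graph G)) (Inr u)"
  have "u \<in> verts G" using u \<open>U \<subseteq> verts G\<close> by blast
  then have "2 \<le> card (S \<inter> ?N)"
    using u by (intro ds_dominating_two_neighbours[OF ds \<open>finite S\<close>])
      (auto simp: verts_splitting_graph simp del: with_proj_simps)
  also have "\<dots> \<le> card (S \<inter> (Inr ` U \<union> Inl ` V))"
    using nbh[OF u(1)] \<open>finite S\<close> \<open>u \<in> verts G\<close>
    by (intro card_mono) (auto simp: neighbourhood_splitting_graph_Inr)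
  finally show ?thesis .
qed

theorem theorem2p3:
  fixes G :: "('a, 'b) pre_digraph" and m n :: nat
  assumes "m \<ge> 2" and "n \<ge> 2" and "K\<^bsub>m,n\<^esub> G"
  shows "ds_domination_number (with_proj (splitting_graph G)) = 4"
proof -
  let ?H = "with_proj (splitting_graph G)"
  obtain U V where "graph G" and verts: "verts G = U \<union> V" and disj: "U \<inter> V = {}"
    and cards: "card U = m" "card V = n" and arcs: "arcs_ends G = U \<times> V \<union> V \<times> U"
    using assms(3) unfolding complete_bipartite_digraph_def by blast
  interpret graph G by fact
  have nbhU: "neighbourhood G u = V" if "u \<in> U" for u
    using that disj by (auto simp: neighbourhood_def arcs)
  have nbhV: "neighbourhood G v = U" if "v \<in> V" for v
    using that disj by (auto simp: neighbourhood_def arcs)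
  have "finite (verts ?H)"
    by (simp add: verts_splitting_graph del: with_proj_simps)

  have lower: "4 \<le> card S" if ds: "ds_dominating ?H S" for S
  proof -
    let ?A = "S \<inter> (Inr ` U \<union> Inl ` V)" and ?B = "S \<inter> (Inr ` V \<union> Inl ` U)"
    have "finite S"
      using ds \<open>finite (verts ?H)\<close> unfolding ds_dominating_def by (blast intro: finite_subset)
    then have "2 \<le> card ?A" "2 \<le> card ?B"
      using assms(1,2) cards verts nbhU nbhV
      by (auto intro!: two_le_card_Int_twins_and_neighbours[OF ds])
    moreover have "card (?A \<union> ?B) = card ?A + card ?B"
      using \<open>finite S\<close> disj by (intro card_Un_disjoint) auto
    moreover have "card (?A \<union> ?B) \<le> card S"
      using \<open>finite S\<close> by (intro card_mono) auto
    ultimately show ?thesis by linarith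
  qed

  have "\<exists>S. ds_dominating ?H S \<and> card S = 4"
  proof -
    obtain u1 u2 where u: "u1 \<in> U" "u2 \<in> U" "u1 \<noteq> u2"
      using assms(1) cards(1) by (metis card_2_iff' obtain_subset_with_card_n subsetD)
    obtain v1 v2 where v: "v1 \<in> V" "v2 \<in> V" "v1 \<noteq> v2"
      using assms(2) cards(2) by (metis card_2_iff' obtain_subset_with_card_n subsetD)
    let ?R = "{Inl u1, Inl v1} :: ('a + 'a) set" and ?B = "{Inl u2, Inl v2} :: ('a + 'a) set"
    have ne: "u1 \<noteq> v1" "u1 \<noteq> v2" "u2 \<noteq> v1" "u2 \<noteq> v2" using u v disj by auto
    have "neighbourhood ?H x \<inter> ?R \<noteq> {} \<and> neighbourhood ?H x \<inter> ?B \<noteq> {}"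
      if x: "x \<in> verts ?H" for x
    proof -
      obtain w where w: "w \<in> verts G" "x = Inl w \<or> x = Inr w"
        using x unfolding verts_splitting_graph by blast
      then have "Inl ` neighbourhood G w \<subseteq> neighbourhood ?H x"
        by (elim disjE) (simp_all add: neighbourhood_splitting_graph_Inr
            Inl_neighbourhood_subset_neighbourhood_splitting_graph)
      moreover have "neighbourhood G w = U \<or> neighbourhood G w = V"
        using w(1) verts nbhU nbhV by blast
      ultimately have "Inl ` U \<subseteq> neighbourhood ?H x \<or> Inl ` V \<subseteq> neighbourhood ?H x"
        by auto
      then show ?thesis using u v by auto
    qed
    moreover have "partition_on (?R \<union> ?B) {?R, ?B}"
      using u v ne by (auto simp: partition_on_def disjoint_def)
    moreover have "?R \<noteq> ?B" using u v ne by auto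
    moreover have "?R \<union> ?B \<subseteq> verts ?H"
      using u v verts unfolding verts_splitting_graph by auto
    ultimately have "ds_dominating ?H (?R \<union> ?B)"
      unfolding ds_dominating_def by blast
    moreover have "card (?R \<union> ?B) = 4" using u v ne by auto
    ultimately show ?thesis by blast
  qed
  then show ?thesis
    unfolding ds_domination_number_def using lower by (intro Least_equality) auto
qed

end
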